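(* Let $f:\mathbb R\to(0,+\infty)$. Then $$\frac{\inf f}{\sup f}\,\mathrm{TV}(\log f)\le\mathrm{WTV}(f)\le\mathrm{TV}(\log f).$$ Moreover, if $f$ is continuous on $\mathbb R$, then $\mathrm{WTV}(f)=\mathrm{TV}(\log f)$.
   Context: $\mathrm{TV}$ denotes the total variation on $\mathbb R$ (possibly $+\infty$). The weighted total variation of $f:\mathbb R\to(0,+\infty)$ is $$\mathrm{WTV}(f)=2\sup\sum_{j=1}^n\frac{|f(x_j)-f(x_{j-1})|}{f(x_j)+f(x_{j-1})},$$ the supremum being taken over all $n\ge1$ and all $(n+1)$-tuples of points $x_0<x_1<\dots<x_n$. *)

theory Defs
  imports "HOL-Analysis.Analysis"
begin

definition total_variation :: "(real \<Rightarrow> real) \<Rightarrow> ereal" where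
  "total_variation g =
     Sup {ereal (\<Sum>j=1..n. \<bar>g (x j) - g (x (j - 1))\<bar>) | (n :: nat) (x :: nat \<Rightarrow> real).
            n \<ge> 1 \<and> strict_mono_on {0..n} x}"

text \<open>Meant for positive functions only, so that the denominators below are positive.\<close>

definition weighted_total_variation :: "(real \<Rightarrow> real) \<Rightarrow> ereal" where
  "weighted_total_variation f =
     2 * Sup {ereal (\<Sum>j=1..n. \<bar>f (x j) - f (x (j - 1))\<bar> / (f (x j) + f (x (j - 1)))) |
                (n :: nat) (x :: nat \<Rightarrow> real). n \<ge> 1 \<and> strict_mono_on {0..n} x}"

end

theory Submission
  imports Defs
begin

text \<open>
  Both quantities are suprema, over all partitions \<open>x 0 < \<dots> < x n\<close>, of sums of two-point costs
  \<open>d (x (j - 1)) (x j)\<close>: the cost \<open>\<bar>ln (f y) - ln (f x)\<bar>\<close> for \<open>TV (log f)\<close>, and the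
  cost \<open>2 * \<bar>f y - f x\<bar> / (f y + f x)\<close> for \<open>WTV f\<close>. The theorem reduces to comparing these.

  For distinct positive \<open>u\<close>, \<open>v\<close>, the mean \<open>\<bar>u - v\<bar> / \<bar>ln u - ln v\<bar>\<close> lies between
  \<open>min u v\<close> and \<open>(u + v) / 2\<close>. The upper bound says that the weighted cost never exceeds the
  logarithmic one (\<open>weighted_cost_le_log_cost\<close>). The lower bound, together with
  \<open>(u + v) / 2 \<le> max u v\<close>, says that it is at least \<open>min u v / max u v\<close> times the logarithmic
  one (\<open>log_cost_le_weighted_cost\<close>). Since \<open>min u v / max u v\<close> is at least \<open>inf f / sup f\<close>, the
  two inequalities follow term by term.

  If \<open>f\<close> is continuous, every \<open>c < 1\<close> is a lower bound for \<open>min u v / max u v\<close> when \<open>u\<close>, \<open>v\<close>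
  are the values of \<open>f\<close> at two points near a given one. The logarithmic cost is subadditive, so
  the property ``some partition of \<open>[a, b]\<close> has weighted sum at least \<open>c\<close> times the logarithmic
  cost of \<open>(a, b)\<close>'' passes from adjacent intervals to their union; by bisection it holds for all
  intervals (\<open>exists_refinement\<close>). Refining each interval of a partition in this way gives
  \<open>c * TV (log f) \<le> WTV f\<close>, and \<open>c\<close> tends to \<open>1\<close>.
\<close>

section \<open>Sums over partitions\<close>

text \<open>
  Refinement and concatenation of partitions only involve the two end points and the sum.
  Recording just these makes both operations rule inductions, without any reindexing of sequences.
\<close>
inductive partition_sum :: "(real \<Rightarrow> real \<Rightarrow> real) \<Rightarrow> real \<Rightarrow> real \<Rightarrow> real \<Rightarrow> bool" for d where
  trivial: "partition_sum d a a 0"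
| extend: "partition_sum d a b s \<Longrightarrow> b < c \<Longrightarrow> partition_sum d a c (s + d b c)"

lemma partition_sum_single: "a < b \<Longrightarrow> partition_sum d a b (d a b)"
  using partition_sum.extend[OF partition_sum.trivial, of a b d] by simp

lemma partition_sum_concat:
  assumes "partition_sum d b c t" and "partition_sum d a b s"
  shows "partition_sum d a c (s + t)"
  using assms
proof (induction rule: partition_sum.induct)
  case (extend b c t e)
  then show ?case
    using partition_sum.extend[of d a c "s + t" e] by (simp add: add.assoc)
qed simp

lemma partition_sum_nonneg:
  assumes "partition_sum d a b s" and "\<And>x y. 0 \<le> d x y"
  shows "0 \<le> s"
  using assms by (induction rule: partition_sum.induct) auto

lemma partition_sum_of_sequence:
  fixes x :: "nat \<Rightarrow> real"
  assumes "strict_mono_on {0..n} x"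
  shows "partition_sum d (x 0) (x n) (\<Sum>j=1..n. d (x (j - 1)) (x j))"
  using assms
proof (induction n)
  case 0
  show ?case using partition_sum.trivial by simp
next
  case (Suc n)
  have "strict_mono_on {0..n} x"
    using Suc.prems by (auto simp: strict_mono_on_def)
  moreover have "x n < x (Suc n)"
    using Suc.prems by (auto simp: strict_mono_on_def)
  ultimately show ?case
    using partition_sum.extend[OF Suc.IH, of "x (Suc n)"] by simp
qed

lemma sequence_of_partition_sum:
  assumes "partition_sum d a b s"
  shows "\<exists>n (x :: nat \<Rightarrow> real). strict_mono_on {0..n} x \<and> x 0 = a \<and> x n = b
           \<and> s = (\<Sum>j=1..n. d (x (j - 1)) (x j))"
  using assms
proof (induction rule: partition_sum.induct)
  case (trivial a)
  have "strict_mono_on {0..0::nat} (\<lambda>_. a)"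
    by (auto simp: strict_mono_on_def)
  then show ?case
    by (intro exI[of _ 0] exI[of _ "\<lambda>_. a"]) auto
next
  case (extend a b s c)
  then obtain n and x :: "nat \<Rightarrow> real"
    where x: "strict_mono_on {0..n} x" "x 0 = a" "x n = b"
      and s: "s = (\<Sum>j=1..n. d (x (j - 1)) (x j))" by blast
  define y where "y = x(Suc n := c)"
  have y_old: "y j = x j" if "j \<le> n" for j
    using that by (simp add: y_def)
  have "x j \<le> b" if "j \<le> n" for j
    using x that by (cases "j = n") (force simp: strict_mono_on_def)+
  then have "strict_mono_on {0..Suc n} y"
    using x(1) \<open>b < c\<close> unfolding strict_mono_on_def y_def
    by (auto simp: le_Suc_eq intro: le_less_trans)
  moreover have "(\<Sum>j=1..n. d (y (j - 1)) (y j)) = s"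
    unfolding s by (rule sum.cong) (auto simp: y_old)
  moreover have "y 0 = a" "y n = b" "y (Suc n) = c"
    using x by (auto simp: y_def)
  ultimately show ?case
    by (intro exI[of _ "Suc n"] exI[of _ y]) simp
qed

definition nontrivial_sums :: "(real \<Rightarrow> real \<Rightarrow> real) \<Rightarrow> real set" where
  "nontrivial_sums d = {s. \<exists>a b. a < b \<and> partition_sum d a b s}"

lemma nontrivial_sums_altdef:
  "nontrivial_sums d =
     {\<Sum>j=1..n. d (x (j - 1)) (x j) | (n :: nat) (x :: nat \<Rightarrow> real). n \<ge> 1 \<and> strict_mono_on {0..n} x}"
  (is "_ = ?R")
proof
  show "nontrivial_sums d \<subseteq> ?R"
  proof
    fix s assume "s \<in> nontrivial_sums d"
    then obtain a b where "a < b" "partition_sum d a b s"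
      by (auto simp: nontrivial_sums_def)
    then obtain n and x :: "nat \<Rightarrow> real" where x: "strict_mono_on {0..n} x" "x 0 < x n"
      and s: "s = (\<Sum>j=1..n. d (x (j - 1)) (x j))"
      using sequence_of_partition_sum by blast
    have "n \<ge> 1" using x(2) by (cases n) auto
    with x(1) s show "s \<in> ?R" by blast
  qed
  show "?R \<subseteq> nontrivial_sums d"
  proof clarify
    fix n :: nat and x :: "nat \<Rightarrow> real"
    assume "n \<ge> 1" and x: "strict_mono_on {0..n} x"
    then have "x 0 < x n" by (auto simp: strict_mono_on_def)
    then show "(\<Sum>j=1..n. d (x (j - 1)) (x j)) \<in> nontrivial_sums d"
      using partition_sum_of_sequence[OF x, of d] by (auto simp: nontrivial_sums_def)
  qed
qed

definition variation_sup :: "(real \<Rightarrow> real \<Rightarrow> real) \<Rightarrow> ereal" where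
  "variation_sup d = (SUP s\<in>nontrivial_sums d. ereal s)"

lemma nontrivial_sums_nonempty: "nontrivial_sums d \<noteq> {}"
proof -
  have "d 0 1 \<in> nontrivial_sums d"
    unfolding nontrivial_sums_def using partition_sum_single[of 0 1 d] zero_less_one by blast
  then show ?thesis by blast
qed

lemma variation_sup_nonneg:
  assumes "\<And>x y. 0 \<le> d x y"
  shows "0 \<le> variation_sup d"
proof -
  obtain s where "s \<in> nontrivial_sums d"
    using nontrivial_sums_nonempty by blast
  moreover from this have "0 \<le> s"
    using partition_sum_nonneg assms by (auto simp: nontrivial_sums_def)
  ultimately show ?thesis
    unfolding variation_sup_def by (intro SUP_upper2) auto
qed

lemma cmult_variation_sup:
  assumes "\<And>x y. 0 \<le> d x y" and "0 \<le> c"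
  shows "(SUP s\<in>nontrivial_sums d. ereal (c * s)) = ereal c * variation_sup d"
proof -
  have "0 \<le> s" if "s \<in> nontrivial_sums d" for s
    using that partition_sum_nonneg assms(1) by (auto simp: nontrivial_sums_def)
  then have "(SUP s\<in>nontrivial_sums d. ereal c * ereal s) = ereal c * variation_sup d"
    unfolding variation_sup_def
    using assms(2) nontrivial_sums_nonempty by (intro SUP_ereal_mult_left) auto
  then show ?thesis by simp
qed

section \<open>Comparison of costs by refinement\<close>

lemma partition_sum_refine:
  assumes "partition_sum e a b s"
    and "\<And>x y. x < y \<Longrightarrow> \<exists>t. partition_sum d x y t \<and> c * e x y \<le> t"
  shows "\<exists>t. partition_sum d a b t \<and> c * s \<le> t"
  using assms(1)
proof (induction rule: partition_sum.induct)
  case (trivial a)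
  then show ?case using partition_sum.trivial by fastforce
next
  case (extend a x s y)
  obtain t where "partition_sum d a x t" "c * s \<le> t"
    using extend.IH by blast
  moreover obtain u where "partition_sum d x y u" "c * e x y \<le> u"
    using assms(2)[OF extend.hyps(2)] by blast
  ultimately show ?case
    using partition_sum_concat by (fastforce simp: algebra_simps)
qed

lemma variation_sup_le_of_refinement:
  assumes "\<And>x y. 0 \<le> e x y" and "0 \<le> c"
    and "\<And>x y. x < y \<Longrightarrow> \<exists>t. partition_sum d x y t \<and> c * e x y \<le> t"
  shows "ereal c * variation_sup e \<le> variation_sup d"
proof -
  have "\<exists>t\<in>nontrivial_sums d. c * s \<le> t" if "s \<in> nontrivial_sums e" for s
    using that partition_sum_refine[OF _ assms(3), of _ _ s] unfolding nontrivial_sums_def by blast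
  then have "(SUP s\<in>nontrivial_sums e. ereal (c * s)) \<le> variation_sup d"
    unfolding variation_sup_def by (intro SUP_mono) auto
  then show ?thesis
    by (simp add: cmult_variation_sup assms)
qed

lemma variation_sup_le_of_cost_le:
  assumes "\<And>x y. 0 \<le> e x y" and "0 \<le> c" and "\<And>x y. x < y \<Longrightarrow> c * e x y \<le> d x y"
  shows "ereal c * variation_sup e \<le> variation_sup d"
  using assms partition_sum_single by (intro variation_sup_le_of_refinement) blast+

text \<open>
  A compactness argument in the form of bisection: subadditivity of \<open>e\<close> makes the conclusion
  stable under joining adjacent intervals, so it need only be checked on short intervals, where
  the partition without interior points suffices.
\<close>
lemma exists_refinement:
  fixes d e :: "real \<Rightarrow> real \<Rightarrow> real"
  assumes "a \<le> b" and "0 \<le> c" and diag: "\<And>x. e x x = 0"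
    and subadd: "\<And>x y z. e x z \<le> e x y + e y z"
    and "local": "\<And>z. \<exists>\<delta>>0. \<forall>x y. x \<le> z \<and> z \<le> y \<and> y - x < \<delta> \<longrightarrow> c * e x y \<le> d x y"
  shows "\<exists>t. partition_sum d a b t \<and> c * e a b \<le> t"
  using \<open>a \<le> b\<close>
proof (induction rule: Bolzano)
  case (trans x y z)
  then obtain s t where "partition_sum d x y s" "c * e x y \<le> s"
      "partition_sum d y z t" "c * e y z \<le> t" by blast
  moreover have "c * e x z \<le> c * e x y + c * e y z"
    using mult_left_mono[OF subadd \<open>0 \<le> c\<close>] by (simp add: distrib_left)
  ultimately show ?case
    using partition_sum_concat by fastforce
next
  case ("local" z)
  obtain \<delta> where "\<delta> > 0"
    and \<delta>: "\<And>x y. x \<le> z \<Longrightarrow> z \<le> y \<Longrightarrow> y - x < \<delta> \<Longrightarrow> c * e x y \<le> d x y"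
    using assms(5)[of z] by blast
  have "\<exists>t. partition_sum d x y t \<and> c * e x y \<le> t"
    if "x \<le> z" "z \<le> y" "y - x < \<delta>" for x y
  proof (cases "x = y")
    case True
    then show ?thesis
      using partition_sum.trivial[of d x] by (auto simp: diag)
  next
    case False
    then show ?thesis
      using that \<delta> partition_sum_single[of x y d] by auto
  qed
  with \<open>\<delta> > 0\<close> show ?case by blast
qed

section \<open>The logarithmic and the weighted cost\<close>

definition log_cost :: "(real \<Rightarrow> real) \<Rightarrow> real \<Rightarrow> real \<Rightarrow> real" where
  "log_cost f x y = \<bar>ln (f y) - ln (f x)\<bar>"

definition weighted_cost :: "(real \<Rightarrow> real) \<Rightarrow> real \<Rightarrow> real \<Rightarrow> real" where
  "weighted_cost f x y = 2 * (\<bar>f y - f x\<bar> / (f y + f x))"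

lemma total_variation_ln_eq: "total_variation (\<lambda>x. ln (f x)) = variation_sup (log_cost f)"
  unfolding total_variation_def variation_sup_def nontrivial_sums_altdef log_cost_def
  by (rule arg_cong[of _ _ Sup]) blast

lemma weighted_total_variation_eq:
  assumes "\<And>x. f x > 0"
  shows "weighted_total_variation f = variation_sup (weighted_cost f)"
proof -
  define h where "h = (\<lambda>x y. \<bar>f y - f x\<bar> / (f y + f x))"
  have h: "0 \<le> h x y" for x y
    using assms[of x] assms[of y] by (simp add: h_def)
  have "weighted_total_variation f = 2 * variation_sup h"
    unfolding weighted_total_variation_def variation_sup_def nontrivial_sums_altdef h_def
    by (rule arg_cong[of _ _ "\<lambda>S. 2 * Sup S"]) blast
  also have "\<dots> = (SUP s\<in>nontrivial_sums h. ereal (2 * s))"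
    using cmult_variation_sup[OF h, of 2] by simp
  also have "\<dots> = variation_sup (weighted_cost f)"
    unfolding variation_sup_def nontrivial_sums_altdef weighted_cost_def h_def
      sum_distrib_left[symmetric]
    by (rule arg_cong[of _ _ Sup]) blast
  finally show ?thesis .
qed

text \<open>
  The trapezoidal lower bound for \<open>ln\<close>: by convexity of \<open>1 / t\<close>, its integral from \<open>u\<close> to \<open>v\<close>
  is at least \<open>v - u\<close> times its value at the midpoint.
\<close>
lemma weighted_cost_le_log_cost:
  assumes "f x > 0" and "f y > 0"
  shows "weighted_cost f x y \<le> log_cost f x y"
proof -
  have "2 * (\<bar>v - u\<bar> / (v + u)) \<le> \<bar>ln v - ln u\<bar>" if "0 < u" "0 < v" for u v :: real
    using that
  proof (induction u v rule: linorder_wlog)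
    case (le u v)
    then show ?case
      using ln_inverse_approx_ge[of u v] by (cases "u = v") (auto simp: add.commute)
  next
    case (sym u v)
    then show ?case by (simp add: abs_minus_commute add.commute)
  qed
  from this[OF assms] show ?thesis
    by (simp add: weighted_cost_def log_cost_def)
qed

text \<open>
  The two hypotheses bounding \<open>c\<close> from above say together that it is at most
  \<open>min (f x) (f y) / max (f x) (f y)\<close>. This factor turns \<open>\<bar>f y - f x\<bar> / min (f x) (f y)\<close>, which
  bounds the logarithmic cost from above, into \<open>\<bar>f y - f x\<bar> / max (f x) (f y)\<close>, which bounds the
  weighted cost from below.
\<close>
lemma log_cost_le_weighted_cost:
  assumes "f x > 0" and "f y > 0" and "0 \<le> c" and "c * f x \<le> f y" and "c * f y \<le> f x"
  shows "c * log_cost f x y \<le> weighted_cost f x y"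
proof -
  have "c * \<bar>ln v - ln u\<bar> \<le> 2 * (\<bar>v - u\<bar> / (v + u))"
    if "0 < u" "0 < v" "c * u \<le> v" "c * v \<le> u" for u v :: real
    using that
  proof (induction u v rule: linorder_wlog)
    case (le u v)
    have "c * (ln v - ln u) = c * ln (v / u)"
      using le by (simp add: ln_div)
    also have "\<dots> \<le> c * (v / u - 1)"
      using le \<open>0 \<le> c\<close> by (intro mult_left_mono ln_le_minus_one) auto
    also have "\<dots> \<le> (u / v) * (v / u - 1)"
      using le by (intro mult_right_mono) (auto simp: field_simps)
    also have "\<dots> = 2 * ((v - u) / (v + v))"
      using le by (simp add: field_simps)
    also have "\<dots> \<le> 2 * ((v - u) / (v + u))"
      using le by (intro mult_left_mono divide_left_mono) auto
    finally show ?case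
      using le by simp
  next
    case (sym u v)
    then show ?case by (simp add: abs_minus_commute add.commute)
  qed
  from this[OF assms(1,2,4,5)] show ?thesis
    by (simp add: weighted_cost_def log_cost_def)
qed

text \<open>
  The quotient is a real number even when the supremum is infinite, because then it is \<open>0\<close>.
\<close>
lemma inf_div_sup_obtain:
  fixes f :: "real \<Rightarrow> real"
  assumes "\<And>x. f x > 0"
  obtains c where "0 \<le> c" and "(INF x. ereal (f x)) / (SUP x. ereal (f x)) = ereal c"
    and "\<And>x y. c * f x \<le> f y"
proof -
  define m M where "m = (INF x. ereal (f x))" and "M = (SUP x. ereal (f x))"
  have m: "m \<le> ereal (f x)" and M: "ereal (f x) \<le> M" for x
    unfolding m_def M_def by (auto intro: INF_lower SUP_upper)
  have "0 \<le> m"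
    unfolding m_def using assms by (intro INF_greatest) (simp add: less_imp_le)
  with m[of 0] obtain m' where m': "m = ereal m'" "0 \<le> m'"
    by (cases m) auto
  have "0 < M"
    using M[of 0] assms[of 0] by (metis ereal_less(2) less_le_trans)
  show ?thesis
  proof (cases M)
    case (real M')
    have "0 < M'" using \<open>0 < M\<close> real by simp
    have "m' / M' * f x \<le> f y" for x y
    proof -
      have "m' / M' * f x \<le> m' / M' * M'"
        using M[of x] real m' \<open>0 < M'\<close> by (intro mult_left_mono) auto
      also have "\<dots> \<le> f y"
        using m[of y] m' \<open>0 < M'\<close> by simp
      finally show ?thesis .
    qed
    then show ?thesis
      using m' \<open>0 < M'\<close> real by (intro that[of "m' / M'"]) (auto simp: m_def M_def)
  next
    case PInf
    then show ?thesis
      using m' assms by (intro that[of 0]) (auto simp: m_def M_def less_imp_le zero_ereal_def)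
  next
    case MInf
    then show ?thesis using \<open>0 < M\<close> by simp
  qed
qed

text \<open>
  Near \<open>z\<close> all values of \<open>f\<close> lie strictly between \<open>sqrt c * f z\<close> and \<open>f z / sqrt c\<close>, and the
  quotient of these two bounds is \<open>c\<close>.
\<close>
lemma local_ratio_bound:
  fixes f :: "real \<Rightarrow> real"
  assumes "continuous_on UNIV f" and "\<And>x. f x > 0" and "0 < c" and "c < 1"
  shows "\<exists>\<delta>>0. \<forall>x y. \<bar>x - z\<bar> < \<delta> \<and> \<bar>y - z\<bar> < \<delta> \<longrightarrow> c * f x \<le> f y"
proof -
  define q where "q = sqrt c"
  have q: "0 < q" "q < 1" "q * q = c"
    using assms by (auto simp: q_def)
  have lim: "(f \<longlongrightarrow> f z) (nhds z)"
    using assms(1) by (simp add: continuous_on_eq_continuous_at isCont_def tendsto_nhds_iff)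
  have "q * f z < f z" "f z < f z / q"
    using q assms(2)[of z] by (auto simp: field_simps)
  then have "\<forall>\<^sub>F x in nhds z. q * f z < f x \<and> f x < f z / q"
    using order_tendstoD[OF lim] by (intro eventually_conj) auto
  then obtain \<delta> where "\<delta> > 0"
    and \<delta>: "\<And>x. \<bar>x - z\<bar> < \<delta> \<Longrightarrow> q * f z < f x \<and> f x < f z / q"
    unfolding eventually_nhds_metric dist_real_def by blast
  have "c * f x \<le> f y" if "\<bar>x - z\<bar> < \<delta>" "\<bar>y - z\<bar> < \<delta>" for x y
  proof -
    have "c * f x \<le> c * (f z / q)"
      using \<delta>[OF that(1)] assms by (intro mult_left_mono) auto
    also have "\<dots> = q * f z"
      using q by (simp add: field_simps)
    also have "\<dots> \<le> f y"
      using \<delta>[OF that(2)] by simp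
    finally show ?thesis .
  qed
  with \<open>\<delta> > 0\<close> show ?thesis by blast
qed

theorem proposition2p1:
  fixes f :: "real \<Rightarrow> real"
  assumes "\<And>x. f x > 0"
  shows "(INF x. ereal (f x)) / (SUP x. ereal (f x)) * total_variation (\<lambda>x. ln (f x))
           \<le> weighted_total_variation f
       \<and> weighted_total_variation f \<le> total_variation (\<lambda>x. ln (f x))
       \<and> (continuous_on UNIV f
             \<longrightarrow> weighted_total_variation f = total_variation (\<lambda>x. ln (f x)))"
proof -
  have log_nonneg: "0 \<le> log_cost f x y" for x y
    by (simp add: log_cost_def)
  have weighted_nonneg: "0 \<le> weighted_cost f x y" for x y
    using assms[of x] assms[of y] by (simp add: weighted_cost_def)
  have lower: "(INF x. ereal (f x)) / (SUP x. ereal (f x)) * variation_sup (log_cost f)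
                 \<le> variation_sup (weighted_cost f)"
  proof -
    obtain c where "0 \<le> c" and c: "(INF x. ereal (f x)) / (SUP x. ereal (f x)) = ereal c"
      and "\<And>x y. c * f x \<le> f y"
      using inf_div_sup_obtain assms by blast
    then show ?thesis
      unfolding c using assms log_nonneg
      by (intro variation_sup_le_of_cost_le log_cost_le_weighted_cost) auto
  qed
  have upper: "variation_sup (weighted_cost f) \<le> variation_sup (log_cost f)"
    using variation_sup_le_of_cost_le[of "weighted_cost f" 1 "log_cost f"]
      weighted_nonneg weighted_cost_le_log_cost[of f] assms
    by (simp add: one_ereal_def[symmetric])
  have cont: "variation_sup (log_cost f) \<le> variation_sup (weighted_cost f)"
    if "continuous_on UNIV f"
  proof (rule ereal_le_mult_one_interval)
    show "variation_sup (weighted_cost f) \<noteq> -\<infinity>"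
      using variation_sup_nonneg[OF weighted_nonneg] by auto
  next
    fix z :: ereal assume "0 < z" "z < 1"
    then obtain c where z: "z = ereal c" and c: "0 < c" "c < 1"
      by (cases z) auto
    have "\<exists>t. partition_sum (weighted_cost f) x y t \<and> c * log_cost f x y \<le> t"
      if "x < y" for x y
    proof (rule exists_refinement)
      fix w
      obtain \<delta> where "\<delta> > 0"
        and "\<And>x y. \<bar>x - w\<bar> < \<delta> \<Longrightarrow> \<bar>y - w\<bar> < \<delta> \<Longrightarrow> c * f x \<le> f y"
        using local_ratio_bound[OF \<open>continuous_on UNIV f\<close> assms c, of w] by blast
      then show "\<exists>\<delta>>0. \<forall>x y. x \<le> w \<and> w \<le> y \<and> y - x < \<delta>
                  \<longrightarrow> c * log_cost f x y \<le> weighted_cost f x y"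
        using c assms by (intro exI[of _ \<delta>]) (auto intro!: log_cost_le_weighted_cost)
    qed (use that c in \<open>auto simp: log_cost_def\<close>)
    then show "z * variation_sup (log_cost f) \<le> variation_sup (weighted_cost f)"
      unfolding z using c log_nonneg by (intro variation_sup_le_of_refinement) auto
  qed
  show ?thesis
    unfolding total_variation_ln_eq weighted_total_variation_eq[OF assms]
    using lower upper cont by (blast intro: antisym)
qed

end
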